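(* Let $\nu$ be a compactly supported Borel probability measure on $\mathbb{R}^d$. For every $r>0$ such that $\underline{\dim}_{M}(\nu)/(r+\dim_{\infty}(\nu))<1$, we have \[ \underline{D}_{r}(\nu)\leq\frac{r\,\underline{\dim}_{M}(\nu)}{r+\dim_{\infty}(\nu)-\underline{\dim}_{M}(\nu)}. \]
   Context: For $n\in\mathbb{N}$ let $\mathcal{D}_n$ be the partition of $\mathbb{R}^d$ into half-open cubes $\prod_{i=1}^d(k_i2^{-n},(k_i+1)2^{-n}]$, $k\in\mathbb{Z}^d$. For $r>0$ let $\mathfrak{e}_{n,r}(\nu)=\inf\left\{\left(\int d(x,\alpha)^r\,d\nu(x)\right)^{1/r}:\alpha\subset\mathbb{R}^d,\ 1\le\mathrm{card}(\alpha)\le n\right\}$ with $d(x,\alpha)=\min_{y\in\alpha}\|x-y\|$. The lower quantization dimension of order $r$ is $\underline{D}_r(\nu)=\liminf_{n\to\infty}\frac{\log n}{-\log\mathfrak{e}_{n,r}(\nu)}$ (the quotient is $0$ if $\mathfrak{e}_{n,r}(\nu)=0$). Further, $\underline{\dim}_M(\nu)$ denotes the lower Minkowski (box-counting) dimension of $\mathrm{supp}(\nu)$, and \[ \dim_{\infty}(\nu)=\liminf_{n\to\infty}\frac{\log\max_{Q\in\mathcal{D}_{n}}\nu(Q)}{-\log2^{n}}. \] *)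

theory Defs
  imports "HOL-Probability.Probability"
begin

definition supp :: "'a::topological_space measure \<Rightarrow> 'a set" where
  "supp \<nu> = {x. \<forall>U. open U \<longrightarrow> x \<in> U \<longrightarrow> emeasure \<nu> U > 0}"

definition dyadic_cubes :: "nat \<Rightarrow> (real ^ 'd) set set" where
  "dyadic_cubes n = range (\<lambda>k :: int ^ 'd.
     {x. \<forall>i. of_int (k $ i) / 2 ^ n < x $ i \<and> x $ i \<le> (of_int (k $ i) + 1) / 2 ^ n})"

text \<open>
  The set of admissible competitors is nonempty and bounded below by 0 for n \<ge> 1, so the
  real-valued Inf is the true infimum. For a compactly supported probability measure the
  integrand is integrable, so the Bochner integral does not fall back to its default value.
\<close>

definition quant_error :: "real \<Rightarrow> nat \<Rightarrow> 'a::euclidean_space measure \<Rightarrow> real" where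
  "quant_error r n \<nu> =
     Inf {(\<integral>x. infdist x \<alpha> powr r \<partial>\<nu>) powr (1 / r) | \<alpha>.
           finite \<alpha> \<and> 1 \<le> card \<alpha> \<and> card \<alpha> \<le> n}"

definition lower_quant_dim :: "real \<Rightarrow> 'a::euclidean_space measure \<Rightarrow> ereal" where
  "lower_quant_dim r \<nu> = liminf (\<lambda>n. ereal
     (if quant_error r n \<nu> = 0 then 0 else ln (real n) / - ln (quant_error r n \<nu>)))"

text \<open>
  Smallest number of sets of diameter at most \<delta> that cover A, meaningful for totally bounded A
  only. Boundedness of the covering sets is required because the library diameter of an
  unbounded set is an unspecified real number.
\<close>

definition cover_number :: "real \<Rightarrow> 'a::metric_space set \<Rightarrow> nat" where
  "cover_number \<delta> A =
     (LEAST m. \<exists>\<U>. finite \<U> \<and> card \<U> = m \<and> A \<subseteq> \<Union>\<U> \<and> (\<forall>U\<in>\<U>. bounded U \<and> diameter U \<le> \<delta>))"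

definition lower_minkowski_dim_set :: "'a::metric_space set \<Rightarrow> ereal" where
  "lower_minkowski_dim_set A =
     Liminf (at_right 0) (\<lambda>\<delta>. ereal (ln (real (cover_number \<delta> A)) / - ln \<delta>))"

definition lower_minkowski_dim :: "'a::metric_space measure \<Rightarrow> ereal" where
  "lower_minkowski_dim \<nu> = lower_minkowski_dim_set (supp \<nu>)"

text \<open>
  The supremum over all cubes is a maximum for a probability measure, since only finitely many
  disjoint cubes can have mass above a given positive threshold. It is written as a supremum
  because the library Max is specified for finite sets only.
\<close>

definition dim_infty :: "(real ^ 'd) measure \<Rightarrow> ereal" where
  "dim_infty \<nu> = liminf (\<lambda>n. ereal
     (ln (SUP Q\<in>dyadic_cubes n. measure \<nu> Q) / - ln (2 ^ n)))"

end

theory Submission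
  imports Defs
begin

text \<open>
  Put \<open>s\<close> for the lower Minkowski dimension and \<open>D\<close> for \<open>dim_infty \<nu>\<close>. One point in every set of a cover
  of the support by sets of diameter at most \<open>\<delta>\<close> gives a quantization error of at most \<open>\<delta>\<close>, whence the
  lower quantization dimension is at most \<open>s\<close>. A set of diameter at most \<open>1 / 2 ^ n\<close> meets a bounded number
  of dyadic cubes of level \<open>n\<close>, and these cubes together carry the mass \<open>1\<close>, whence \<open>D \<le> s\<close>. Therefore
  \<open>r + D - s \<le> r\<close> and \<open>s \<le> r * s / (r + D - s)\<close>.
\<close>

section \<open>The support of a measure\<close>

text \<open>The complement of the support is the union of all open null sets. That family may be
  uncountable, but by Lindelof a countable subfamily has the same union.\<close>

lemma AE_in_supp:
  fixes \<nu> :: "'a::second_countable_topology measure"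
  assumes "sets \<nu> = sets borel"
  shows "AE x in \<nu>. x \<in> supp \<nu>"
proof -
  define F where "F = {U. open U \<and> emeasure \<nu> U = 0}"
  have "- supp \<nu> = \<Union>F"
    by (auto simp: supp_def F_def zero_less_iff_neq_zero)
  moreover obtain F' where F': "F' \<subseteq> F" "countable F'" "\<Union>F' = \<Union>F"
    using Lindelof[of F] by (auto simp: F_def)
  moreover have "(\<Union>U\<in>F'. U) \<in> null_sets \<nu>"
    using F' assms by (intro null_sets_UN') (auto simp: F_def null_sets_def)
  ultimately have "- supp \<nu> \<in> null_sets \<nu>"
    by simp
  then show ?thesis
    by (rule AE_I') auto
qed

lemma supp_nonempty:
  fixes \<nu> :: "'a::second_countable_topology measure"
  assumes "prob_space \<nu>" "sets \<nu> = sets borel"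
  shows "supp \<nu> \<noteq> {}"
proof
  interpret prob_space \<nu> by fact
  assume "supp \<nu> = {}"
  with AE_in_supp[OF assms(2)] show False
    by simp
qed

section \<open>Covering numbers and the quantization error\<close>

text \<open>Balls of radius \<open>\<delta> / 2\<close> around a finite net show that some
  cardinality is admissible, so the \<open>LEAST\<close> in the definition is attained.\<close>

lemma cover_number_witness:
  fixes A :: "'a::metric_space set"
  assumes "compact A" "\<delta> > 0"
  obtains \<U> where "finite \<U>" "card \<U> = cover_number \<delta> A" "A \<subseteq> \<Union>\<U>"
    "\<And>U. U \<in> \<U> \<Longrightarrow> bounded U \<and> diameter U \<le> \<delta>"
proof -
  let ?P = "\<lambda>m. \<exists>\<U>. finite \<U> \<and> card \<U> = m \<and> A \<subseteq> \<Union>\<U> \<and> (\<forall>U\<in>\<U>. bounded U \<and> diameter U \<le> \<delta>)"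
  obtain k where k: "finite k" "A \<subseteq> (\<Union>x\<in>k. ball x (\<delta> / 2))"
    using compact_eq_totally_bounded[of A] assms by (metis half_gt_zero)
  have "diameter (ball x (\<delta> / 2)) \<le> \<delta>" for x :: 'a
  proof -
    have "dist y z \<le> \<delta>" if "y \<in> ball x (\<delta> / 2)" "z \<in> ball x (\<delta> / 2)" for y z
      using that dist_triangle_half_r[of x y \<delta> z] by simp
    then show ?thesis
      unfolding diameter_def using assms(2) by (auto intro!: cSUP_least)
  qed
  with k have "?P (card ((\<lambda>x. ball x (\<delta> / 2)) ` k))"
    by (intro exI[of _ "(\<lambda>x. ball x (\<delta> / 2)) ` k"]) auto
  then have "?P (cover_number \<delta> A)"
    unfolding cover_number_def by (rule LeastI)
  then show ?thesis
    using that by blast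
qed

lemma quant_error_nonneg:
  assumes "0 < n"
  shows "0 \<le> quant_error r n \<nu>"
  unfolding quant_error_def
proof (rule cInf_greatest)
  show "{(\<integral>x. infdist x \<alpha> powr r \<partial>\<nu>) powr (1 / r) |\<alpha>.
      finite \<alpha> \<and> 1 \<le> card \<alpha> \<and> card \<alpha> \<le> n} \<noteq> {}"
    \<comment> \<open>Since \<open>n\<close> is positive, any one-point set is a competitor. For
      \<open>n = 0\<close> there would be none, and the value of \<open>Inf\<close> would be
      unspecified.\<close>
    using assms by (auto intro!: exI[of _ "{undefined}"])
qed auto

lemma quant_error_le_cover_diameter:
  fixes \<nu> :: "'a::euclidean_space measure"
  assumes "prob_space \<nu>" "sets \<nu> = sets borel" "compact (supp \<nu>)" "r > 0" "\<delta> > 0"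
    and "cover_number \<delta> (supp \<nu>) \<le> n"
  shows "quant_error r n \<nu> \<le> \<delta>"
proof -
  interpret prob_space \<nu> by fact
  obtain \<U> where \<U>: "finite \<U>" "card \<U> = cover_number \<delta> (supp \<nu>)" "supp \<nu> \<subseteq> \<Union>\<U>"
    "\<And>U. U \<in> \<U> \<Longrightarrow> bounded U \<and> diameter U \<le> \<delta>"
    using cover_number_witness[OF assms(3,5)] by metis
  \<comment> \<open>An empty member of the cover contributes an arbitrary point. This is harmless:
    the distance estimate only uses members that contain a point of the support.\<close>
  define \<alpha> where "\<alpha> = (\<lambda>U. SOME x. x \<in> U) ` \<U>"
  have \<U>_ne: "\<U> \<noteq> {}"
    using supp_nonempty[OF assms(1,2)] \<U>(3) by auto
  have \<alpha>: "finite \<alpha>" "1 \<le> card \<alpha>" "card \<alpha> \<le> n"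
    using \<U>(1,2) \<U>_ne assms(6) card_image_le[OF \<U>(1), of "\<lambda>U. SOME x. x \<in> U"]
    by (auto simp: \<alpha>_def Suc_le_eq card_gt_0_iff)
  have dist: "infdist x \<alpha> \<le> \<delta>" if "x \<in> supp \<nu>" for x
  proof -
    obtain U where U: "U \<in> \<U>" "x \<in> U"
      using \<open>x \<in> supp \<nu>\<close> \<U>(3) by blast
    then have "(SOME x. x \<in> U) \<in> U"
      by (metis someI)
    then have "dist x (SOME x. x \<in> U) \<le> \<delta>"
      using U \<U>(4)[OF U(1)] diameter_bounded_bound[of U x] by force
    then show ?thesis
      using U(1) infdist_le2[of "SOME x. x \<in> U" \<alpha> x \<delta>] by (auto simp: \<alpha>_def)
  qed
  have meas: "(\<lambda>x. infdist x \<alpha> powr r) \<in> borel_measurable \<nu>"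
    unfolding measurable_cong_sets[OF assms(2) refl]
    by (intro powr_real_measurable borel_measurable_const borel_measurable_continuous_onI
        continuous_on_infdist continuous_on_id)
  have ae: "AE x in \<nu>. infdist x \<alpha> powr r \<le> \<delta> powr r"
    using AE_in_supp[OF assms(2)]
    by eventually_elim (use assms(4) in \<open>auto intro!: powr_mono2 dist infdist_nonneg\<close>)
  have "integrable \<nu> (\<lambda>x. infdist x \<alpha> powr r)"
    by (rule integrable_const_bound[of _ "\<delta> powr r"]) (use ae meas in auto)
  then have "(\<integral>x. infdist x \<alpha> powr r \<partial>\<nu>) \<le> \<delta> powr r"
    using ae by (rule integral_le_const)
  moreover have "0 \<le> (\<integral>x. infdist x \<alpha> powr r \<partial>\<nu>)"
    by (intro integral_nonneg_AE) auto
  ultimately have "(\<integral>x. infdist x \<alpha> powr r \<partial>\<nu>) powr (1 / r) \<le> (\<delta> powr r) powr (1 / r)"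
    using assms(4) by (intro powr_mono2) auto
  also have "\<dots> = \<delta>"
    using assms(4,5) by (simp add: powr_powr)
  finally have "(\<integral>x. infdist x \<alpha> powr r \<partial>\<nu>) powr (1 / r) \<le> \<delta>" .
  moreover have "quant_error r n \<nu> \<le> (\<integral>x. infdist x \<alpha> powr r \<partial>\<nu>) powr (1 / r)"
    unfolding quant_error_def
    by (rule cInf_lower) (use \<alpha> in \<open>auto intro!: bdd_belowI[of _ 0]\<close>)
  ultimately show ?thesis
    by simp
qed

section \<open>Lower Minkowski dimension as an upper bound for the lower quantization
  dimension\<close>

lemma lower_minkowski_dim_nonneg: "0 \<le> lower_minkowski_dim \<nu>"
  unfolding lower_minkowski_dim_def lower_minkowski_dim_set_def
proof (rule Liminf_bounded)
  have "eventually (\<lambda>\<delta>::real. \<delta> \<in> {0<..<1}) (at_right 0)"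
    by (rule eventually_at_right_real) simp
  then show "eventually (\<lambda>\<delta>. 0 \<le> ereal (ln (real (cover_number \<delta> (supp \<nu>))) / - ln \<delta>)) (at_right 0)"
  proof eventually_elim
    case (elim \<delta>)
    have "0 \<le> ln (real (cover_number \<delta> (supp \<nu>)))"
      by (cases "cover_number \<delta> (supp \<nu>) = 0") auto
    moreover have "0 \<le> - ln \<delta>"
      using elim by simp
    ultimately have "0 \<le> ln (real (cover_number \<delta> (supp \<nu>))) / - ln \<delta>"
      by (rule divide_nonneg_nonneg)
    then show ?case
      by simp
  qed
qed

text \<open>This is the contrapositive of \<open>Liminf_bounded\<close>: the quotient cannot
  eventually stay above \<open>s\<close>. Multiplying out by \<open>- ln \<delta>\<close> removes
  the division.\<close>

lemma frequently_cover_number_le: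
  assumes "lower_minkowski_dim \<nu> < ereal s"
  shows "\<exists>\<^sub>F \<delta> in at_right 0. 0 < \<delta> \<and> \<delta> < 1 \<and> ln (real (cover_number \<delta> (supp \<nu>))) \<le> s * - ln \<delta>"
proof (rule ccontr)
  assume "\<not> ?thesis"
  then have "\<forall>\<^sub>F \<delta> in at_right 0.
      \<not> (0 < \<delta> \<and> \<delta> < 1 \<and> ln (real (cover_number \<delta> (supp \<nu>))) \<le> s * - ln \<delta>)"
    by (simp add: frequently_def)
  moreover have "eventually (\<lambda>\<delta>::real. \<delta> \<in> {0<..<1}) (at_right 0)"
    by (rule eventually_at_right_real) simp
  ultimately have "\<forall>\<^sub>F \<delta> in at_right 0. ereal s \<le> ereal (ln (real (cover_number \<delta> (supp \<nu>))) / - ln \<delta>)"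
  proof eventually_elim
    case (elim \<delta>)
    then have "s * - ln \<delta> \<le> ln (real (cover_number \<delta> (supp \<nu>)))" "0 < - ln \<delta>"
      by auto
    then have "s \<le> ln (real (cover_number \<delta> (supp \<nu>))) / - ln \<delta>"
      by (simp only: pos_le_divide_eq)
    then show ?case
      by simp
  qed
  then have "ereal s \<le> lower_minkowski_dim \<nu>"
    unfolding lower_minkowski_dim_def lower_minkowski_dim_set_def by (rule Liminf_bounded)
  with assms show False
    by simp
qed

text \<open>Together with \<open>frequently_cover_number_le\<close> it supplies a scale with few
  covering sets that is also as small as desired.\<close>

lemma eventually_le_neg_ln: "\<forall>\<^sub>F \<delta> in at_right 0. C \<le> - ln (\<delta>::real)"
proof -
  have "eventually (\<lambda>\<delta>::real. \<delta> \<in> {0<..<exp (- C)}) (at_right 0)"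
    by (rule eventually_at_right_real) simp
  then show ?thesis
  proof eventually_elim
    case (elim \<delta>)
    then have "ln \<delta> < ln (exp (- C))"
      by (subst ln_less_cancel_iff) auto
    then show ?case
      by simp
  qed
qed

lemma ereal_le_if_less_real_imp_le:
  fixes x y :: ereal
  assumes "\<And>t. y < ereal t \<Longrightarrow> x \<le> ereal t"
  shows "x \<le> y"
  using assms ereal_dense2[of y x] by (meson not_le)

lemma liminf_le_of_frequently_le:
  fixes f :: "nat \<Rightarrow> ereal"
  assumes "\<And>N. \<exists>n\<ge>N. f n \<le> c"
  shows "liminf f \<le> c"
proof (rule ccontr)
  assume "\<not> liminf f \<le> c"
  then have "c < liminf f"
    by simp
  then have "\<forall>\<^sub>F n in sequentially. c < f n"
    by (rule less_LiminfD)
  then obtain N where "\<forall>n\<ge>N. c < f n"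
    by (auto simp: eventually_sequentially)
  with assms[of N] show False
    by force
qed

lemma lower_quant_dim_le_lower_minkowski_dim:
  fixes \<nu> :: "'a::euclidean_space measure"
  assumes "prob_space \<nu>" "sets \<nu> = sets borel" "compact (supp \<nu>)" "r > 0"
  shows "lower_quant_dim r \<nu> \<le> lower_minkowski_dim \<nu>"
proof (rule ereal_le_if_less_real_imp_le)
  fix s assume s: "lower_minkowski_dim \<nu> < ereal s"
  with lower_minkowski_dim_nonneg[of \<nu>] have "0 < s"
    by (metis ereal_less(2) le_less_trans)
  show "lower_quant_dim r \<nu> \<le> ereal s"
    unfolding lower_quant_dim_def
  proof (rule liminf_le_of_frequently_le)
    fix N
    let ?m = "\<lambda>\<delta>. cover_number \<delta> (supp \<nu>)"
    obtain \<delta> where \<delta>: "0 < \<delta>" "\<delta> < 1" "ln (real (?m \<delta>)) \<le> s * - ln \<delta>" "ln (real (Suc N)) / s \<le> - ln \<delta>"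
      using frequently_ex[OF frequently_eventually_conj[OF frequently_cover_number_le[OF s]
          eventually_le_neg_ln[of "ln (real (Suc N)) / s"]]] by auto
    \<comment> \<open>The index must exceed \<open>N\<close> for the lower limit and reach the cover
      number for the error bound. The last condition on \<delta> keeps
      \<open>ln n \<le> s * - ln \<delta>\<close> true when \<open>Suc N\<close> is the larger of
      the two.\<close>
    define n where "n = max (Suc N) (?m \<delta>)"
    define q where "q = quant_error r n \<nu>"
    have ln_n: "ln (real n) \<le> s * - ln \<delta>"
      using \<delta>(3,4) \<open>0 < s\<close> by (auto simp: n_def max_def field_simps)
    have q: "q \<le> \<delta>"
      unfolding q_def
      by (rule quant_error_le_cover_diameter[OF assms \<delta>(1)]) (simp add: n_def)
    \<comment> \<open>If \<open>q = 0\<close>, the quotient is 0 by definition and thus below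
      \<open>s\<close>. Otherwise \<open>q \<le> \<delta> < 1\<close>, so passing from \<delta> to
      \<open>q\<close> only enlarges the positive denominator.\<close>
    have "ln (real n) / - ln q \<le> s" if "q \<noteq> 0"
    proof -
      have "q > 0"
        using that quant_error_nonneg[of n r \<nu>] by (simp add: q_def n_def less_max_iff_disj)
      then have "- ln \<delta> \<le> - ln q" "0 < - ln q"
        using q \<delta>(1,2) by auto
      then have "s * - ln \<delta> \<le> s * - ln q"
        using \<open>0 < s\<close> by (intro mult_left_mono) auto
      with ln_n have "ln (real n) \<le> s * - ln q"
        by linarith
      with \<open>0 < - ln q\<close> show ?thesis
        by (simp only: pos_divide_le_eq)
    qed
    with \<open>0 < s\<close> show "\<exists>n\<ge>N. ereal (if quant_error r n \<nu> = 0 then 0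
        else ln (real n) / - ln (quant_error r n \<nu>)) \<le> ereal s"
      by (intro exI[of _ n]) (auto simp: q_def n_def)
  qed
qed

section \<open>Dyadic cubes\<close>

lemma dyadic_cube_borel:
  fixes Q :: "(real ^ 'd) set"
  assumes "Q \<in> dyadic_cubes n"
  shows "Q \<in> sets borel"
proof -
  obtain k :: "int ^ 'd" where Q: "Q = {x. \<forall>i. of_int (k $ i) / 2 ^ n < x $ i
      \<and> x $ i \<le> (of_int (k $ i) + 1) / 2 ^ n}"
    using assms unfolding dyadic_cubes_def by auto
  have nth: "(\<lambda>x :: real ^ 'd. x $ i) \<in> borel_measurable borel" for i
    by (intro borel_measurable_continuous_onI continuous_intros)
  have "{x \<in> space (borel :: (real ^ 'd) measure). \<forall>i\<in>UNIV. of_int (k $ i) / 2 ^ n < x $ i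
      \<and> x $ i \<le> (of_int (k $ i) + 1) / 2 ^ n} \<in> sets borel"
    by (intro sets.sets_Collect_finite_All sets.sets_Collect_conj
        borel_measurable_less borel_measurable_le nth borel_measurable_const finite)
  then show ?thesis
    by (simp add: Q)
qed

text \<open>A real \<open>y\<close> lies in the cell from \<open>k\<close> (excluded) to
  \<open>k + 1\<close> (included) exactly for \<open>k = \<lceil>y\<rceil> - 1\<close>. The interval
  therefore lists the unit cells met by the points within \<open>c\<close> of
  \<open>a\<close>.\<close>

lemma card_int_ceiling_box:
  assumes "0 \<le> (c::real)"
  shows "real (card {\<lceil>a - c\<rceil> - 1 .. \<lceil>a + c\<rceil> - 1}) \<le> 2 * c + 2"
proof -
  have "\<lceil>a - c\<rceil> \<le> \<lceil>a + c\<rceil>"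
    using assms by (intro ceiling_mono) auto
  then have "real (card {\<lceil>a - c\<rceil> - 1 .. \<lceil>a + c\<rceil> - 1}) = of_int \<lceil>a + c\<rceil> - of_int \<lceil>a - c\<rceil> + 1"
    by simp
  then show ?thesis
    using ceiling_correct[of "a + c"] ceiling_correct[of "a - c"] by linarith
qed

text \<open>After scaling by \<open>2 ^ n\<close>, every coordinate of a point of \<open>A\<close>
  is within \<open>c * 2 ^ n\<close> of a fixed number, so \<open>card_int_ceiling_box\<close>
  bounds the indices per coordinate. The cubes are indexed by the product of these ranges.\<close>

lemma dyadic_cover_box:
  fixes A :: "(real ^ 'd) set" and a :: "real ^ 'd"
  assumes "0 \<le> c" "\<And>x i. x \<in> A \<Longrightarrow> \<bar>x $ i - a $ i\<bar> \<le> c"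
  obtains F where "finite F" "F \<subseteq> dyadic_cubes n" "A \<subseteq> \<Union>F"
    "real (card F) \<le> (2 * c * 2 ^ n + 2) ^ CARD('d)"
proof -
  define S where "S = (\<lambda>i. {\<lceil>a $ i * 2 ^ n - c * 2 ^ n\<rceil> - 1 .. \<lceil>a $ i * 2 ^ n + c * 2 ^ n\<rceil> - 1})"
  define cube where "cube = (\<lambda>k :: int ^ 'd.
     {x :: real ^ 'd. \<forall>i. of_int (k $ i) / 2 ^ n < x $ i \<and> x $ i \<le> (of_int (k $ i) + 1) / 2 ^ n})"
  define F where "F = (\<lambda>f. cube (vec_lambda f)) ` (PiE UNIV S)"
  have fin: "finite (PiE UNIV S)"
    by (intro finite_PiE) (auto simp: S_def)
  show ?thesis
  proof
    show "finite F"
      using fin by (simp add: F_def)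
    show "F \<subseteq> dyadic_cubes n"
      unfolding F_def dyadic_cubes_def cube_def[symmetric] by blast
    show "A \<subseteq> \<Union>F"
    proof
      fix x assume x: "x \<in> A"
      define f where "f = (\<lambda>i. \<lceil>x $ i * 2 ^ n\<rceil> - 1)"
      have "a $ i * 2 ^ n - c * 2 ^ n \<le> x $ i * 2 ^ n" "x $ i * 2 ^ n \<le> a $ i * 2 ^ n + c * 2 ^ n" for i
        using assms(2)[OF x, of i] by (auto simp flip: distrib_right left_diff_distrib)
      then have "f \<in> PiE UNIV S"
        unfolding f_def S_def PiE_UNIV_domain
        by (intro Pi_I, unfold atLeastAtMost_iff) (intro conjI diff_right_mono ceiling_mono)
      moreover have "x \<in> cube (vec_lambda f)"
        unfolding cube_def f_def
        by (auto simp: field_simps) (smt (verit) ceiling_correct)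
      ultimately show "x \<in> \<Union>F"
        unfolding F_def by blast
    qed
    have "real (card F) \<le> real (card (PiE UNIV S))"
      unfolding F_def using fin by (intro of_nat_mono card_image_le)
    also have "\<dots> = (\<Prod>i\<in>UNIV. real (card (S i)))"
      by (simp add: card_PiE)
    also have "\<dots> \<le> (\<Prod>i\<in>(UNIV::'d set). 2 * (c * 2 ^ n) + 2)"
      unfolding S_def using assms(1) by (intro prod_mono conjI of_nat_0_le_iff card_int_ceiling_box) auto
    finally show "real (card F) \<le> (2 * c * 2 ^ n + 2) ^ CARD('d)"
      by (simp add: mult.assoc)
  qed
qed

lemma
  fixes \<nu> :: "(real ^ 'd) measure"
  assumes "prob_space \<nu>"
  shows measure_le_SUP_dyadic_cubes:
      "Q \<in> dyadic_cubes n \<Longrightarrow> measure \<nu> Q \<le> (SUP Q\<in>dyadic_cubes n. measure \<nu> Q)"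
    and SUP_dyadic_cubes_nonneg: "0 \<le> (SUP Q\<in>dyadic_cubes n. measure \<nu> Q)"
    and SUP_dyadic_cubes_le_1: "(SUP Q\<in>dyadic_cubes n. measure \<nu> Q) \<le> 1"
proof -
  interpret prob_space \<nu> by fact
  have ne: "dyadic_cubes n \<noteq> ({} :: (real ^ 'd) set set)"
    by (simp add: dyadic_cubes_def)
  show upper: "measure \<nu> Q \<le> (SUP Q\<in>dyadic_cubes n. measure \<nu> Q)" if "Q \<in> dyadic_cubes n" for Q
    using that by (intro cSUP_upper) (auto intro!: bdd_aboveI[of _ 1])
  show "0 \<le> (SUP Q\<in>dyadic_cubes n. measure \<nu> Q)"
    using ne upper by (meson ex_in_conv measure_nonneg order_trans)
  show "(SUP Q\<in>dyadic_cubes n. measure \<nu> Q) \<le> 1"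
    using ne by (intro cSUP_least) auto
qed

text \<open>A pigeonhole bound: the cubes in \<open>F\<close> carry the full mass, and none carries
  more than the supremum.\<close>

lemma one_le_card_mult_SUP_dyadic_cubes:
  fixes \<nu> :: "(real ^ 'd) measure"
  assumes "prob_space \<nu>" "sets \<nu> = sets borel"
    and "finite F" "F \<subseteq> dyadic_cubes n" "supp \<nu> \<subseteq> \<Union>F"
  shows "1 \<le> real (card F) * (SUP Q\<in>dyadic_cubes n. measure \<nu> Q)"
proof -
  interpret prob_space \<nu> by fact
  have F: "F \<subseteq> sets \<nu>"
    using assms(2,4) dyadic_cube_borel by auto
  have "AE x in \<nu>. x \<in> \<Union>F"
    using AE_in_supp[OF assms(2)] by eventually_elim (use assms(5) in blast)
  then have "1 = measure \<nu> (\<Union>F)"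
    using AE_in_set_eq_1[OF sets.finite_Union[OF assms(3) F]] by simp
  also have "\<dots> \<le> (\<Sum>Q\<in>F. measure \<nu> Q)"
    using finite_measure_subadditive_finite[of F "\<lambda>Q. Q"] F assms(3) by auto
  also have "\<dots> \<le> (\<Sum>Q\<in>F. SUP Q\<in>dyadic_cubes n. measure \<nu> Q)"
    using assms(4) by (intro sum_mono measure_le_SUP_dyadic_cubes[OF assms(1)]) auto
  finally show ?thesis
    by simp
qed

section \<open>Bounds for \<open>dim_infty\<close>\<close>

lemma dim_infty_nonneg:
  assumes "prob_space \<nu>"
  shows "0 \<le> dim_infty \<nu>"
  unfolding dim_infty_def
proof (rule Liminf_bounded, rule always_eventually, rule allI)
  fix n
  let ?\<mu> = "SUP Q\<in>dyadic_cubes n. measure \<nu> Q"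
  have "ln ?\<mu> \<le> 0"
    using SUP_dyadic_cubes_nonneg[OF assms, of n] SUP_dyadic_cubes_le_1[OF assms, of n]
    by (cases "?\<mu> = 0") auto
  moreover have "- ln ((2::real) ^ n) \<le> 0"
    by simp
  \<comment> \<open>At \<open>n = 0\<close> the denominator vanishes and the quotient is 0 by
    convention; the rule for nonpositive numbers includes this case.\<close>
  ultimately have "0 \<le> ln ?\<mu> / - ln (2 ^ n)"
    by (rule divide_nonpos_nonpos)
  then show "0 \<le> ereal (ln ?\<mu> / - ln (2 ^ n))"
    by simp
qed

lemma neg_ln_le_of_one_le_mult:
  assumes "1 \<le> K * \<mu>" "0 \<le> (\<mu>::real)"
  shows "0 < K" "0 < \<mu>" "- ln \<mu> \<le> ln K"
proof -
  show \<mu>: "0 < \<mu>"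
    using assms by (cases "\<mu> = 0") auto
  show K: "0 < K"
    using assms \<mu> by (smt (verit) mult_nonpos_nonneg)
  have "0 \<le> ln (K * \<mu>)"
    using assms(1) by simp
  then show "- ln \<mu> \<le> ln K"
    using K \<mu> by (simp add: ln_mult)
qed

text \<open>A lower limit is bounded by a bound along infinitely many levels, and
  \<open>0 < n\<close> makes the denominator \<open>n * ln 2\<close> positive.\<close>

lemma dim_infty_le_if_frequently:
  assumes "\<And>N. \<exists>n\<ge>N. 0 < n \<and> - ln (SUP Q\<in>dyadic_cubes n. measure \<nu> Q) \<le> t * (real n * ln 2)"
  shows "dim_infty \<nu> \<le> ereal t"
  unfolding dim_infty_def
proof (rule liminf_le_of_frequently_le)
  fix N
  obtain n where n: "n \<ge> N" "0 < n" "- ln (SUP Q\<in>dyadic_cubes n. measure \<nu> Q) \<le> t * (real n * ln 2)"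
    using assms by blast
  then have "- ln (SUP Q\<in>dyadic_cubes n. measure \<nu> Q) / (real n * ln 2) \<le> t"
    by (subst pos_divide_le_eq) auto
  with n(1) show "\<exists>n\<ge>N. ereal (ln (SUP Q\<in>dyadic_cubes n. measure \<nu> Q) / - ln (2 ^ n)) \<le> ereal t"
    by (intro exI[of _ n]) (auto simp: ln_realpow)
qed

text \<open>A bounded set meets at most a constant times \<open>2 ^ (n * CARD('d))\<close> cubes of
  level \<open>n\<close>, so the supremum decays at most exponentially in \<open>n\<close>. This
  finiteness gives the hypothesis of the theorem its intended meaning, since a quotient by
  \<infinity> is 0 in \<open>ereal\<close>.\<close>

lemma dim_infty_less_infinity:
  fixes \<nu> :: "(real ^ 'd) measure"
  assumes "prob_space \<nu>" "sets \<nu> = sets borel" "compact (supp \<nu>)"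
  shows "dim_infty \<nu> < \<infinity>"
proof -
  obtain M where M: "0 < M" "\<And>x. x \<in> supp \<nu> \<Longrightarrow> norm x \<le> M"
    using compact_imp_bounded[OF assms(3)] by (auto simp: bounded_pos)
  define C where "C = ln (2 * M + 2) / ln 2"
  have "dim_infty \<nu> \<le> ereal (CARD('d) * (C + 1))"
  proof (rule dim_infty_le_if_frequently)
    fix N
    define n where "n = Suc N"
    let ?\<mu> = "SUP Q\<in>dyadic_cubes n. measure \<nu> Q"
    have "\<bar>x $ i - (0 :: real ^ 'd) $ i\<bar> \<le> M" if "x \<in> supp \<nu>" for x i
      using M(2)[OF that] component_le_norm_cart[of x i] by simp
    then obtain F where F: "finite F" "F \<subseteq> dyadic_cubes n" "supp \<nu> \<subseteq> \<Union>F"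
      "real (card F) \<le> (2 * M * 2 ^ n + 2) ^ CARD('d)"
      using dyadic_cover_box[of M "supp \<nu>" 0 n] M(1) by (metis less_imp_le)
    have "(2 * M * 2 ^ n + 2) \<le> (2 * M + 2) * 2 ^ n"
      by (simp add: distrib_right)
    then have "(2 * M * 2 ^ n + 2) ^ CARD('d) \<le> ((2 * M + 2) * 2 ^ n) ^ CARD('d)"
      using M(1) by (intro power_mono) auto
    with F(4) have "real (card F) \<le> ((2 * M + 2) * 2 ^ n) ^ CARD('d)"
      by linarith
    then have "real (card F) * ?\<mu> \<le> ((2 * M + 2) * 2 ^ n) ^ CARD('d) * ?\<mu>"
      by (intro mult_right_mono SUP_dyadic_cubes_nonneg assms)
    then have "1 \<le> ((2 * M + 2) * 2 ^ n) ^ CARD('d) * ?\<mu>"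
      using one_le_card_mult_SUP_dyadic_cubes[OF assms(1,2) F(1-3)] by linarith
    then have "- ln ?\<mu> \<le> ln (((2 * M + 2) * 2 ^ n) ^ CARD('d))"
      by (rule neg_ln_le_of_one_le_mult) (rule SUP_dyadic_cubes_nonneg[OF assms(1)])
    also have "\<dots> = CARD('d) * (C * ln 2 + real n * ln 2)"
      using M(1) by (simp add: ln_realpow ln_mult C_def)
    \<comment> \<open>As \<open>C\<close> is nonnegative and \<open>n\<close> is at least 1, the
      constant term \<open>C * ln 2\<close> is absorbed into one linear in \<open>n\<close>.\<close>
    also have "\<dots> \<le> CARD('d) * (C * (real n * ln 2) + real n * ln 2)"
      using M(1) by (intro mult_left_mono add_right_mono) (auto simp: C_def n_def)
    also have "\<dots> = CARD('d) * (C + 1) * (real n * ln 2)"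
      by (simp add: algebra_simps)
    finally show "\<exists>n\<ge>N. 0 < n \<and> - ln (SUP Q\<in>dyadic_cubes n. measure \<nu> Q)
        \<le> CARD('d) * (C + 1) * (real n * ln 2)"
      by (intro exI[of _ n]) (auto simp: n_def)
  qed
  then show ?thesis
    by (rule le_less_trans) simp
qed

text \<open>Each covering set lies within \<open>1 / 2 ^ n\<close> of one of its points in every
  coordinate. With \<open>c = 1 / 2 ^ n\<close> the box bound is
  \<open>2 * c * 2 ^ n + 2 = 4\<close> indices per coordinate.\<close>

lemma one_le_cover_number_mult_SUP_dyadic_cubes:
  fixes \<nu> :: "(real ^ 'd) measure"
  assumes "prob_space \<nu>" "sets \<nu> = sets borel" "compact (supp \<nu>)" "0 < \<delta>" "\<delta> \<le> 1 / 2 ^ n"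
  shows "1 \<le> real (cover_number \<delta> (supp \<nu>)) * 4 ^ CARD('d) * (SUP Q\<in>dyadic_cubes n. measure \<nu> Q)"
proof -
  let ?\<mu> = "SUP Q\<in>dyadic_cubes n. measure \<nu> Q"
  obtain \<U> where \<U>: "finite \<U>" "card \<U> = cover_number \<delta> (supp \<nu>)" "supp \<nu> \<subseteq> \<Union>\<U>"
    "\<And>U. U \<in> \<U> \<Longrightarrow> bounded U \<and> diameter U \<le> \<delta>"
    using cover_number_witness[OF assms(3,4)] by metis
  have "\<exists>F. finite F \<and> F \<subseteq> dyadic_cubes n \<and> U \<subseteq> \<Union>F \<and> real (card F) \<le> 4 ^ CARD('d)"
    if U: "U \<in> \<U>" for U
  proof -
    have "\<bar>x $ i - (SOME x. x \<in> U) $ i\<bar> \<le> 1 / 2 ^ n" if x: "x \<in> U" for x i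
    proof -
      have "(SOME x. x \<in> U) \<in> U"
        using x by (metis someI)
      then have "norm (x - (SOME x. x \<in> U)) \<le> \<delta>"
        using x \<U>(4)[OF U] diameter_bounded_bound[of U x] by (force simp: dist_norm)
      then show ?thesis
        using component_le_norm_cart[of "x - (SOME x. x \<in> U)" i] assms(5) by simp
    qed
    then obtain F where "finite F" "F \<subseteq> dyadic_cubes n" "U \<subseteq> \<Union>F"
      "real (card F) \<le> (2 * (1 / 2 ^ n) * 2 ^ n + 2) ^ CARD('d)"
      using dyadic_cover_box[of "1 / 2 ^ n" U "SOME x. x \<in> U" n]
      by (metis zero_le_divide_1_iff zero_le_numeral zero_le_power)
    then show ?thesis
      by auto
  qed
  then obtain F where F: "\<And>U. U \<in> \<U> \<Longrightarrow> finite (F U) \<and> F U \<subseteq> dyadic_cubes n \<and> U \<subseteq> \<Union>(F U)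
      \<and> real (card (F U)) \<le> 4 ^ CARD('d)"
    by metis
  have "real (card (\<Union>(F ` \<U>))) \<le> (\<Sum>U\<in>\<U>. real (card (F U)))"
    using card_UN_le[OF \<U>(1), of F] by (simp flip: of_nat_sum)
  also have "\<dots> \<le> (\<Sum>U\<in>\<U>. 4 ^ CARD('d))"
    using F by (intro sum_mono) auto
  also have "\<dots> = real (cover_number \<delta> (supp \<nu>)) * 4 ^ CARD('d)"
    by (simp add: \<U>(2))
  finally have "real (card (\<Union>(F ` \<U>))) * ?\<mu> \<le> real (cover_number \<delta> (supp \<nu>)) * 4 ^ CARD('d) * ?\<mu>"
    by (intro mult_right_mono SUP_dyadic_cubes_nonneg assms)
  moreover have "1 \<le> real (card (\<Union>(F ` \<U>))) * ?\<mu>"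
  proof (rule one_le_card_mult_SUP_dyadic_cubes[OF assms(1,2)])
    show "finite (\<Union>(F ` \<U>))" "\<Union>(F ` \<U>) \<subseteq> dyadic_cubes n"
      using F \<U>(1) by auto
    have "\<Union>\<U> \<subseteq> \<Union>(\<Union>(F ` \<U>))"
    proof
      fix x assume "x \<in> \<Union>\<U>"
      then obtain U where "U \<in> \<U>" "x \<in> \<Union>(F U)"
        using F by blast
      then show "x \<in> \<Union>(\<Union>(F ` \<U>))"
        by auto
    qed
    with \<U>(3) show "supp \<nu> \<subseteq> \<Union>(\<Union>(F ` \<U>))"
      by (rule order_trans)
  qed
  ultimately show ?thesis
    by linarith
qed

lemma dim_infty_le_lower_minkowski_dim:
  fixes \<nu> :: "(real ^ 'd) measure"
  assumes "prob_space \<nu>" "sets \<nu> = sets borel" "compact (supp \<nu>)"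
  shows "dim_infty \<nu> \<le> lower_minkowski_dim \<nu>"
proof (rule ereal_le_if_less_real_imp_le)
  fix t assume t: "lower_minkowski_dim \<nu> < ereal t"
  \<comment> \<open>The gap \<open>e\<close> between \<open>s\<close> and \<open>t\<close> leaves
    room to absorb a constant \<open>C\<close> that does not depend on the level.\<close>
  obtain s where s: "lower_minkowski_dim \<nu> < ereal s" "ereal s < ereal t"
    using ereal_dense2[OF t] by blast
  define e where "e = t - s"
  have "0 < e" "t = s + e"
    using s(2) by (auto simp: e_def)
  from s(1) lower_minkowski_dim_nonneg[of \<nu>] have "0 < s"
    by (metis ereal_less(2) le_less_trans)
  \<comment> \<open>The summand \<open>s\<close> pays for rounding
    \<open>- ln \<delta> / ln 2\<close> up to \<open>n + 1\<close>, and \<open>2 * CARD('d)\<close>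
    is the logarithm of \<open>4 ^ CARD('d)\<close> to base 2.\<close>
  define C where "C = s + 2 * CARD('d)"
  show "dim_infty \<nu> \<le> ereal t"
  proof (rule dim_infty_le_if_frequently)
    fix N
    let ?m = "\<lambda>\<delta>. cover_number \<delta> (supp \<nu>)"
    \<comment> \<open>From level \<open>N'\<close> on, \<open>C \<le> e * n\<close> holds. The scale
      is then chosen below \<open>1 / 2 ^ (N' + 1)\<close> or equal to it, which forces the level
      \<open>n\<close> to be at least \<open>N'\<close>.\<close>
    define N' where "N' = Suc (max N (nat \<lceil>C / e\<rceil>))"
    have N': "N \<le> N'" "0 < N'" "C / e \<le> real N'"
      unfolding N'_def by (auto simp: max_def) linarith+
    obtain \<delta> where \<delta>: "0 < \<delta>" "\<delta> < 1" "ln (real (?m \<delta>)) \<le> s * - ln \<delta>" "real (Suc N') * ln 2 \<le> - ln \<delta>"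
      using frequently_ex[OF frequently_eventually_conj[OF frequently_cover_number_le[OF s(1)]
          eventually_le_neg_ln[of "real (Suc N') * ln 2"]]] by auto
    \<comment> \<open>This is the finest level with \<open>\<delta> \<le> 1 / 2 ^ n\<close>, hence
      \<open>- ln \<delta>\<close> exceeds \<open>n * ln 2\<close> by at most
      \<open>ln 2\<close>.\<close>
    define n where "n = nat \<lfloor>- ln \<delta> / ln 2\<rfloor>"
    let ?\<mu> = "SUP Q\<in>dyadic_cubes n. measure \<nu> Q"
    have "0 \<le> - ln \<delta> / ln 2"
      using \<delta> by (intro divide_nonneg_nonneg) auto
    then have "real n \<le> - ln \<delta> / ln 2" "- ln \<delta> / ln 2 \<le> real n + 1"
      unfolding n_def by linarith+
    then have n: "real n * ln 2 \<le> - ln \<delta>" "- ln \<delta> \<le> (real n + 1) * ln 2"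
      by (auto simp: field_simps)
    have "real (Suc N') * ln 2 \<le> (real n + 1) * ln 2"
      using n(2) \<delta>(4) by linarith
    then have "N' \<le> n"
      by (simp)
    have "C / e \<le> real n"
      using N'(3) \<open>N' \<le> n\<close> by linarith
    then have C: "C \<le> e * real n"
      using \<open>0 < e\<close> by (simp add: field_simps)
    have "ln \<delta> \<le> ln (1 / 2 ^ n)"
      using n(1) by (simp add: ln_div ln_realpow)
    then have "\<delta> \<le> 1 / 2 ^ n"
      using \<delta>(1) by (subst (asm) ln_le_cancel_iff) auto
    from one_le_cover_number_mult_SUP_dyadic_cubes[OF assms \<delta>(1) this]
    have le: "1 \<le> real (?m \<delta>) * 4 ^ CARD('d) * ?\<mu>" .
    note pos = neg_ln_le_of_one_le_mult[OF le SUP_dyadic_cubes_nonneg[OF assms(1)]]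
    have "ln (4::real) = 2 * ln 2"
      using ln_realpow[of 2 2] by simp
    with pos have "- ln ?\<mu> \<le> ln (real (?m \<delta>)) + 2 * CARD('d) * ln 2"
      by (simp add: ln_mult ln_realpow zero_less_mult_iff)
    also have "\<dots> \<le> s * ((real n + 1) * ln 2) + 2 * CARD('d) * ln 2"
      using \<delta>(3) mult_left_mono[OF n(2), of s] \<open>0 < s\<close> by linarith
    also have "\<dots> = s * (real n * ln 2) + C * ln 2"
      by (simp add: C_def algebra_simps)
    also have "\<dots> \<le> s * (real n * ln 2) + e * real n * ln 2"
      using C by (intro add_left_mono mult_right_mono) auto
    also have "\<dots> = t * (real n * ln 2)"
      by (simp add: \<open>t = s + e\<close> algebra_simps)
    finally show "\<exists>n\<ge>N. 0 < n \<and> - ln (SUP Q\<in>dyadic_cubes n. measure \<nu> Q) \<le> t * (real n * ln 2)"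
      using N' \<open>N' \<le> n\<close> by (intro exI[of _ n]) auto
  qed
qed

theorem proposition1p7:
  fixes \<nu> :: "(real ^ 'd) measure" and r :: real
  assumes "prob_space \<nu>"
    and "sets \<nu> = sets borel"
    and "compact (supp \<nu>)"
    and "r > 0"
    and "lower_minkowski_dim \<nu> / (ereal r + dim_infty \<nu>) < 1"
  shows "lower_quant_dim r \<nu> \<le>
    ereal r * lower_minkowski_dim \<nu> / (ereal r + dim_infty \<nu> - lower_minkowski_dim \<nu>)"
proof -
  obtain D where D: "dim_infty \<nu> = ereal D" "0 \<le> D"
    using dim_infty_nonneg[OF assms(1)] dim_infty_less_infinity[OF assms(1-3)]
    by (cases "dim_infty \<nu>") auto
  \<comment> \<open>With the finite positive denominator \<open>r + D\<close>, an infinite numerator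
    would make the quotient in the hypothesis infinite.\<close>
  have "lower_minkowski_dim \<nu> \<noteq> \<infinity>"
    using assms(4,5) D by auto
  then obtain s where s: "lower_minkowski_dim \<nu> = ereal s" "0 \<le> s"
    using lower_minkowski_dim_nonneg[of \<nu>] by (cases "lower_minkowski_dim \<nu>") auto
  have "D \<le> s"
    using dim_infty_le_lower_minkowski_dim[OF assms(1-3)] D s by simp
  \<comment> \<open>This makes \<open>r + D - s\<close> positive, so the remaining comparison is one
    of real quotients.\<close>
  have "s < r + D"
    using assms(4,5) D s by (simp add: one_ereal_def)
  have "s * (r + D - s) \<le> s * r"
    using \<open>D \<le> s\<close> s(2) by (intro mult_left_mono) auto
  then have "s \<le> r * s / (r + D - s)"
    using \<open>s < r + D\<close> by (subst pos_le_divide_eq) (auto simp: mult.commute)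
  then have "lower_minkowski_dim \<nu> \<le> ereal r * lower_minkowski_dim \<nu>
      / (ereal r + dim_infty \<nu> - lower_minkowski_dim \<nu>)"
    using \<open>s < r + D\<close> by (simp add: D s)
  with lower_quant_dim_le_lower_minkowski_dim[OF assms(1-4)] show ?thesis
    by (rule order_trans)
qed

end
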